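(* As $x \to \infty$ through composite odd integers, $$\pi_2(x) \sim \bigl(2 \pm o(\log x)\bigr)\frac{x}{\log^2 x}.$$ That is, there exists a real-valued function $h$ (of either sign) with $h(x)/\log x \to 0$ as $x\to\infty$ such that $$\lim_{x\to\infty} \frac{\pi_2(x)}{\bigl(2 + h(x)\bigr)\, x/\log^2 x} = 1.$$
   Context: Throughout, $x$ denotes a composite odd positive integer, and $\log$ is the natural logarithm. $\pi_2(x)$ denotes the number of pairs $(p,p')$ of consecutive primes, with both members less than $x$, whose gap $p'-p$ is at most two; that is, the number of twin prime pairs below $x$ together with the pair $(2,3)$. (For example, $\pi_2(25)=5$.) The notation $\pm o(\log x)$ stands for an unspecified quantity, of either sign, whose quotient by $\log x$ tends to $0$ as $x \to \infty$. *)

theory Defs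
  imports Complex_Main "HOL-Computational_Algebra.Primes"
begin

definition consecutive_primes :: "nat \<Rightarrow> nat \<Rightarrow> bool" where
  "consecutive_primes p p' \<longleftrightarrow>
     prime p \<and> prime p' \<and> p < p' \<and> (\<forall>q. p < q \<and> q < p' \<longrightarrow> \<not> prime q)"

definition twin_pairs_below :: "nat \<Rightarrow> (nat \<times> nat) set" where
  "twin_pairs_below x = {(p, p'). consecutive_primes p p' \<and> p < x \<and> p' < x \<and> p' - p \<le> 2}"

(* The pair (2, 3) is counted along with the twin prime pairs. *)
definition pi2 :: "nat \<Rightarrow> nat" where
  "pi2 x = card (twin_pairs_below x)"

lemma finite_twin_pairs_below: "finite (twin_pairs_below x)"
  by (rule finite_subset[of _ "{..<x} \<times> {..<x}"]) (auto simp: twin_pairs_below_def)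

definition odd_composites :: "nat set" where
  "odd_composites = {x. odd x \<and> 1 < x \<and> \<not> prime x}"

(* The filter for "x tends to infinity through composite odd integers". *)
definition at_top_odd_composites :: "nat filter" where
  "at_top_odd_composites = inf at_top (principal odd_composites)"

lemma eventually_at_top_odd_composites:
  "eventually P at_top_odd_composites \<longleftrightarrow> (\<exists>N. \<forall>x\<ge>N. x \<in> odd_composites \<longrightarrow> P x)"
  by (simp add: at_top_odd_composites_def eventually_inf_principal eventually_at_top_linorder)

lemma at_top_odd_composites_neq_bot: "at_top_odd_composites \<noteq> bot"
proof -
  have "\<exists>x\<ge>N. x \<in> odd_composites" for N :: nat
  proof (intro exI conjI)
    show "N \<le> 3 * (2 * N + 3)" by simp
    have "\<not> prime (3 * (2 * N + 3))"
      using prime_product[of 3 "2 * N + 3"] by auto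
    then show "3 * (2 * N + 3) \<in> odd_composites"
      by (simp add: odd_composites_def)
  qed
  then show ?thesis
    by (simp add: trivial_limit_def eventually_at_top_odd_composites)
qed

end

theory Submission
  imports Defs
    "HOL-Analysis.Harmonic_Numbers"
    "HOL-Computational_Algebra.Squarefree"
    "HOL-Number_Theory.Cong"
    "HOL-Real_Asymp.Real_Asymp"
begin

text \<open>
  The function \<open>h\<close> is free to be chosen, so take
  \<open>h x = \<pi>\<^sub>2 x * (ln x)\<^sup>2 / x - 2\<close>. The ratio in the second limit is then exactly \<open>1\<close>
  (the pair \<open>(2, 3)\<close> keeps it from being \<open>0 / 0\<close>), and the first limit says precisely that
  \<open>\<pi>\<^sub>2 x = o(x / ln x)\<close>: twin primes have density zero among the primes. That is the content
  of the theorem.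

  The proof is Brun's pure sieve. For a finite set \<open>P\<close> of odd primes with
  \<open>S = \<Sum>p\<in>P. 1 / p\<close>, each \<open>p \<in> P\<close> forbids the two residue classes \<open>0\<close> and \<open>-2\<close> to the lower
  member of a twin pair (unless that member is itself small), so one expects at most about
  \<open>x * (\<Prod>p\<in>P. 1 - 2 / p) \<le> x * exp (- 2 * S)\<close> pairs. Inclusion-exclusion over all subsets of
  \<open>P\<close> has too many error terms; the Bonferroni inequality (\<open>Bonferroni_upper\<close>) allows one to keep
  only the subsets with at most \<open>k\<close> elements, for an even \<open>k\<close>. If \<open>k \<ge> 8 * S\<close>, the omitted
  part of the main term is again at most \<open>exp (- 2 * S)\<close> (\<open>Rankin_tail\<close>), and the error is at
  most \<open>(1 + 2 * card P) ^ k\<close>. This gives \<open>Brun_sieve\<close>.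

  To beat \<open>x / ln x\<close> it is enough that \<open>S\<close> is a little above \<open>ln (ln x) / 2\<close>, while an
  upper bound for \<open>S\<close> keeps \<open>k\<close>, and thus the error, small. A lower bound for sums of prime reciprocals,
  \<open>ln_ln_le_sum_prime_reciprocals\<close>, follows from writing every integer as a squarefree number
  times a square. The upper bound for \<open>S\<close> is arranged by the choice of \<open>P\<close>, which is cut out of
  the primes up to \<open>exp ((ln x) powr 0.7)\<close> so that \<open>S\<close> lies between \<open>0.6 * ln (ln x)\<close> and
  \<open>0.6 * ln (ln x) + 1\<close> (\<open>exists_subset_sum_between\<close>).
\<close>

section \<open>A lower bound for the sum of the reciprocals of the primes\<close>

lemma sum_inverse_squares_le_2: "(\<Sum>d=1..N. 1 / real d ^ 2) \<le> 2"
proof -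
  have "(\<Sum>d=1..N. 1 / real d ^ 2) \<le> 2 - 1 / real N" if "N \<ge> 1"
    using that
  proof (induction N rule: dec_induct)
    case (step n)
    \<comment> \<open>Telescoping comparison, which is why the bound \<open>2 - 1 / N\<close> is the one to induct on.\<close>
    have "1 / real (Suc n) ^ 2 \<le> 1 / real n - 1 / real (Suc n)"
    proof -
      have "1 / real n - 1 / real (Suc n) = 1 / (real n * real (Suc n))"
        using step.hyps by (simp add: field_simps)
      moreover have "1 / (real (Suc n) * real (Suc n)) \<le> 1 / (real n * real (Suc n))"
        using step.hyps by (intro divide_left_mono mult_right_mono mult_pos_pos) auto
      ultimately show ?thesis by (simp add: power2_eq_square)
    qed
    then show ?case using step by simp
  qed simp
  moreover have "2 - 1 / real N \<le> 2" by simp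
  moreover have "(\<Sum>d=1..N. 1 / real d ^ 2) \<le> 2" if "\<not> N \<ge> 1" using that by simp
  ultimately show ?thesis by linarith
qed

lemma squarefree_eq_prod_prime_factors:
  fixes m :: nat
  assumes "squarefree m"
  shows "m = \<Prod>(prime_factors m)"
proof -
  have "m \<noteq> 0" using assms by (metis not_squarefree_0)
  then have "m = (\<Prod>p\<in>prime_factors m. p ^ multiplicity p m)"
    by (simp add: prime_factorization_nat)
  also have "\<dots> = (\<Prod>p\<in>prime_factors m. p)"
  proof (rule prod.cong[OF refl])
    fix p assume p: "p \<in> prime_factors m"
    have "multiplicity p m \<le> 1" "multiplicity p m > 0"
      using assms p squarefree_factorial_semiring''[of m] \<open>m \<noteq> 0\<close>
      by (auto simp: prime_factors_multiplicity in_prime_factors_iff)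
    then have "multiplicity p m = 1" by simp
    then show "p ^ multiplicity p m = p" by simp
  qed
  finally show ?thesis .
qed

text \<open>
  Every \<open>n \<le> N\<close> is a squarefree number, that is, a product over a set of primes up to \<open>N\<close>, times a
  square \<open>d\<^sup>2\<close> with \<open>d \<le> N\<close>. Expanding the right-hand side yields the reciprocals of all numbers
  of this shape, among them each \<open>1 / n\<close> at least once. The factors \<open>1 + 1 / p\<close> are
  convenient because they are at most \<open>exp (1 / p)\<close>.
\<close>

lemma harm_le_prod_primes:
  "(harm N :: real) \<le> (\<Prod>p | prime p \<and> p \<le> N. 1 + 1 / real p) * (\<Sum>d=1..N. 1 / real d ^ 2)"
proof -
  define Q where "Q = {p. prime p \<and> p \<le> N}"
  have finQ: "finite Q" by (rule finite_subset[of _ "{..N}"]) (auto simp: Q_def)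
  define g where "g = (\<lambda>n::nat. (prime_factors (squarefree_part n), square_part n))"
  define w where "w = (\<lambda>(D, d). (\<Prod>p\<in>D. 1 / real p) * (1 / real d ^ 2))"
  have prod_g: "squarefree_part n = \<Prod>(prime_factors (squarefree_part n))" for n :: nat
    by (rule squarefree_eq_prod_prime_factors) simp
  have inj: "inj_on g {1..N}"
    unfolding inj_on_def g_def by (metis prod_g prod.inject squarefree_decomposition_unique)
  have sub: "g ` {1..N} \<subseteq> Pow Q \<times> {1..N}"
  proof
    fix y assume "y \<in> g ` {1..N}"
    then obtain n where n: "1 \<le> n" "n \<le> N" and y: "y = g n" by auto
    have dvd: "squarefree_part n dvd n" "square_part n dvd n"
      by (metis squarefree_decompose dvd_triv_left)
         (metis squarefree_decompose dvd_triv_right dvd_power dvd_trans zero_less_numeral)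
    then have "squarefree_part n \<le> N" "square_part n \<le> N"
      using n dvd_imp_le[OF dvd(1)] dvd_imp_le[OF dvd(2)] by linarith+
    moreover have "p \<le> squarefree_part n" if "p \<in> prime_factors (squarefree_part n)" for p
      using that by (intro dvd_imp_le) (auto intro: gr0I)
    moreover have "square_part n \<ge> 1" using n
      by (metis One_nat_def Suc_leI gr0I not_one_le_zero square_part_0_iff)
    ultimately show "y \<in> Pow Q \<times> {1..N}"
      by (force simp: y g_def Q_def)
  qed
  have "harm N = (\<Sum>n\<in>{1..N}. w (g n))"
    unfolding harm_def
  proof (rule sum.cong[OF refl])
    fix n assume "n \<in> {1..N}"
    have "inverse (real n) = inverse (real (squarefree_part n * square_part n ^ 2))"
      by (simp flip: squarefree_decompose)
    also have "\<dots> = inverse (real (\<Prod>(prime_factors (squarefree_part n)))) * (1 / real (square_part n) ^ 2)"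
      by (simp flip: prod_g add: divide_simps)
    also have "\<dots> = w (g n)"
      by (simp add: w_def g_def of_nat_prod prod_dividef divide_simps)
    finally show "inverse (of_nat n) = w (g n)" by simp
  qed
  also have "\<dots> = sum w (g ` {1..N})"
    by (simp only: sum.reindex[OF inj] o_def)
  also have "\<dots> \<le> sum w (Pow Q \<times> {1..N})"
    using finQ sub by (intro sum_mono2) (auto simp: w_def intro!: divide_nonneg_nonneg prod_nonneg)
  also have "\<dots> = (\<Sum>D\<in>Pow Q. \<Prod>p\<in>D. 1 / real p) * (\<Sum>d=1..N. 1 / real d ^ 2)"
    by (simp add: w_def sum_product sum.cartesian_product)
  also have "(\<Sum>D\<in>Pow Q. \<Prod>p\<in>D. 1 / real p) = (\<Prod>p\<in>Q. 1 / real p + 1)"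
    by (subst prod_add[OF finQ]) simp
  finally show ?thesis by (simp add: Q_def add.commute)
qed

lemma prod_one_plus_le_exp_sum:
  fixes f :: "'a \<Rightarrow> real"
  assumes "\<And>x. x \<in> A \<Longrightarrow> 1 + f x \<ge> 0"
  shows "(\<Prod>x\<in>A. 1 + f x) \<le> exp (\<Sum>x\<in>A. f x)"
proof (cases "finite A")
  case True
  have "(\<Prod>x\<in>A. 1 + f x) \<le> (\<Prod>x\<in>A. exp (f x))"
    using assms by (intro prod_mono) (auto simp: exp_ge_add_one_self)
  then show ?thesis using True by (simp add: exp_sum)
qed auto

lemma ln_ln_le_sum_prime_reciprocals:
  assumes "N \<ge> 1"
  shows "ln (ln (real N + 1)) \<le> (\<Sum>p | prime p \<and> p \<le> N. 1 / real p) + ln 2"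
proof -
  have "ln (real N + 1) \<le> (harm N :: real)" by (rule ln_le_harm)
  also have "\<dots> \<le> (\<Prod>p | prime p \<and> p \<le> N. 1 + 1 / real p) * (\<Sum>d=1..N. 1 / real d ^ 2)"
    by (rule harm_le_prod_primes)
  also have "\<dots> \<le> exp (\<Sum>p | prime p \<and> p \<le> N. 1 / real p) * 2"
    by (intro mult_mono prod_one_plus_le_exp_sum sum_inverse_squares_le_2)
       (auto intro: sum_nonneg)
  finally have "ln (real N + 1) \<le> exp (\<Sum>p | prime p \<and> p \<le> N. 1 / real p) * 2" .
  moreover have "ln (real N + 1) > 0" using assms by simp
  ultimately have "ln (ln (real N + 1)) \<le> ln (exp (\<Sum>p | prime p \<and> p \<le> N. 1 / real p) * 2)"
    by (subst ln_le_cancel_iff) auto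
  then show ?thesis by (simp add: ln_mult)
qed

text \<open>The constant absorbs \<open>ln 2 \<le> 1\<close> and the discarded term \<open>1 / 2\<close> of the prime \<open>2\<close>.\<close>

lemma sum_odd_prime_reciprocals_ge:
  assumes "N \<ge> 2"
  shows "ln (ln (real N + 1)) - 3 / 2 \<le> (\<Sum>p | prime p \<and> odd p \<and> p \<le> N. 1 / real p)"
proof -
  have "{p. prime p \<and> p \<le> N} = insert 2 {p. prime p \<and> odd p \<and> p \<le> N}"
    using assms primes_dvd_imp_eq[of "2::nat"] by auto
  moreover have "finite {p. prime p \<and> odd p \<and> p \<le> N}" by (rule finite_subset[of _ "{..N}"]) auto
  ultimately have "(\<Sum>p | prime p \<and> p \<le> N. 1 / real p)
      = 1 / 2 + (\<Sum>p | prime p \<and> odd p \<and> p \<le> N. 1 / real p)"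
    by simp
  moreover have "ln 2 \<le> (1::real)" using ln_2_less_1 by simp
  ultimately show ?thesis using ln_ln_le_sum_prime_reciprocals[of N] assms by simp
qed

section \<open>Counting solutions of \<open>p dvd n * (n + 2)\<close> for several primes\<close>

lemma card_less_mod_eq:
  fixes m r X :: nat
  assumes "r < m"
  shows "\<bar>real (card {n. n < X \<and> n mod m = r}) - real X / real m\<bar> \<le> 1"
proof -
  \<comment> \<open>The number of \<open>k\<close> with \<open>k * m + r < X\<close>.\<close>
  define c where "c = (if r < X then (X - r - 1) div m + 1 else 0)"
  have "{n. n < X \<and> n mod m = r} = (\<lambda>k. k * m + r) ` {..<c}"
  proof (intro set_eqI iffI)
    fix n assume "n \<in> {n. n < X \<and> n mod m = r}"
    then have n: "n < X" "n = (n div m) * m + r" by auto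
    then have "(n div m) * m \<le> X - r - 1" "r < X" by linarith+
    then have "n div m < c"
      using assms by (auto simp: c_def less_Suc_eq_le less_eq_div_iff_mult_less_eq)
    then show "n \<in> (\<lambda>k. k * m + r) ` {..<c}" using n by blast
  next
    fix n assume "n \<in> (\<lambda>k. k * m + r) ` {..<c}"
    then obtain k where k: "k < c" and n: "n = k * m + r" by auto
    then have "r < X" "k \<le> (X - r - 1) div m" by (auto simp: c_def split: if_splits)
    then have "k * m \<le> X - r - 1"
      using assms by (simp add: less_eq_div_iff_mult_less_eq)
    then show "n \<in> {n. n < X \<and> n mod m = r}" using n \<open>r < X\<close> assms by auto
  qed
  moreover have "inj_on (\<lambda>k. k * m + r) {..<c}"
    using assms by (auto simp: inj_on_def)
  ultimately have card: "card {n. n < X \<and> n mod m = r} = c"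
    by (simp add: card_image)
  have "real c * m \<le> X + m" "X \<le> real c * m + m"
  proof -
    have "c * m \<le> X + m \<and> X \<le> c * m + m"
    proof (cases "r < X")
      case True
      have "(X - r - 1) div m * m \<le> X - r - 1" by simp
      moreover have "X - r - 1 < (X - r - 1) div m * m + m"
        using assms dividend_less_div_times[of m "X - r - 1"] by simp
      moreover have "c * m = (X - r - 1) div m * m + m" using True by (simp add: c_def)
      ultimately show ?thesis using True assms by linarith
    qed (use assms in \<open>auto simp: c_def\<close>)
    then show "real c * m \<le> X + m" "X \<le> real c * m + m"
      by (metis of_nat_add of_nat_le_iff of_nat_mult)+
  qed
  then show ?thesis using assms unfolding card
    by (simp add: abs_le_iff field_simps)
qed

text \<open>
  By the Chinese remainder theorem the conditions for \<open>p \<in> D\<close> describe \<open>2 ^ card D\<close> residue classes,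
  each counted with an error of at most \<open>1\<close>. Carrying along one further congruence modulo \<open>m\<close> makes
  this an induction on \<open>D\<close>: a new prime \<open>p\<close> splits the class of \<open>a\<close> modulo \<open>m\<close> into two classes
  modulo \<open>m * p\<close>. They are distinct because \<open>p\<close> is odd.
\<close>

lemma card_twin_residues:
  fixes m a X :: nat
  assumes "finite D" "\<And>p. p \<in> D \<Longrightarrow> prime p \<and> odd p \<and> coprime m p" "m > 0"
  shows "\<bar>real (card {n. n < X \<and> [n = a] (mod m) \<and> (\<forall>p\<in>D. p dvd n * (n + 2))})
            - real X / real m * (\<Prod>p\<in>D. 2 / real p)\<bar> \<le> 2 ^ card D"
  using assms
proof (induction D arbitrary: m a rule: finite_induct)
  case empty
  then show ?case using card_less_mod_eq[of "a mod m" m X] by (simp add: unique_euclidean_semiring_class.cong_def)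
next
  case (insert p D)
  have p: "prime p" "odd p" "coprime m p" using insert.prems by auto
  have "p > 2" using p prime_ge_2_nat[of p] by (cases "p = 2") auto
  obtain b where b: "[b = a] (mod m)" "[b = 0] (mod p)"
    using binary_chinese_remainder_nat[OF p(3)] by blast
  \<comment> \<open>The residue \<open>p - 2\<close> is the natural number representing \<open>-2\<close> modulo \<open>p\<close>.\<close>
  obtain c where c: "[c = a] (mod m)" "[c = p - 2] (mod p)"
    using binary_chinese_remainder_nat[OF p(3)] by blast
  define A where "A u = {n. n < X \<and> [n = u] (mod m * p) \<and> (\<forall>q\<in>D. q dvd n * (n + 2))}" for u
  have cong_mult: "[n = u] (mod m * p) \<longleftrightarrow> [n = u] (mod m) \<and> [n = u] (mod p)" for n u
  proof
    assume *: "[n = u] (mod m * p)"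
    show "[n = u] (mod m) \<and> [n = u] (mod p)"
      using cong_dvd_modulus_nat[OF *, of m] cong_dvd_modulus_nat[OF *, of p] by simp
  qed (use p(3) in \<open>auto intro: coprime_cong_mult_nat\<close>)
  have cong_b: "[n = b] (mod m * p) \<longleftrightarrow> [n = a] (mod m) \<and> p dvd n" for n
    using b unfolding cong_mult
    by (simp add: unique_euclidean_semiring_class.cong_def dvd_eq_mod_eq_0)
  have cong_c: "[n = c] (mod m * p) \<longleftrightarrow> [n = a] (mod m) \<and> p dvd n + 2" for n
  proof -
    have "[n = p - 2] (mod p) \<longleftrightarrow> [n + 2 = p - 2 + 2] (mod p)"
      by (rule cong_add_rcancel_nat[symmetric])
    moreover have "p - 2 + 2 = p" using \<open>p > 2\<close> by simp
    moreover have "[n + 2 = p] (mod p) \<longleftrightarrow> p dvd n + 2"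
      by (simp add: unique_euclidean_semiring_class.cong_def dvd_eq_mod_eq_0)
    ultimately show ?thesis using c unfolding cong_mult
      by (simp add: unique_euclidean_semiring_class.cong_def)
  qed
  have split: "{n. n < X \<and> [n = a] (mod m) \<and> (\<forall>q\<in>insert p D. q dvd n * (n + 2))} = A b \<union> A c"
    using prime_dvd_mult_iff[OF p(1)] unfolding A_def cong_b cong_c by blast
  have disj: "A b \<inter> A c = {}"
  proof -
    have False if "p dvd n" "p dvd n + 2" for n
      using dvd_diff_nat[OF that(2,1)] dvd_imp_le[of p 2] \<open>p > 2\<close> by simp
    then show ?thesis by (auto simp: A_def cong_b cong_c)
  qed
  have "finite (A u)" for u by (simp add: A_def)
  then have card: "real (card (A b \<union> A c)) = real (card (A b)) + real (card (A c))"
    using disj by (simp add: card_Un_disjoint)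
  have IH: "\<bar>real (card (A u)) - real X / real (m * p) * (\<Prod>p\<in>D. 2 / real p)\<bar> \<le> 2 ^ card D" for u
    unfolding A_def
  proof (rule insert.IH)
    show "m * p > 0" using insert.prems p by (simp add: prime_gt_0_nat)
    fix q assume "q \<in> D"
    then have "prime q" "odd q" "coprime m q" "p \<noteq> q" using insert by auto
    then show "prime q \<and> odd q \<and> coprime (m * p) q"
      using p(1) by (auto simp: primes_coprime)
  qed
  have main: "real X / real m * (\<Prod>p\<in>insert p D. 2 / real p)
      = 2 * (real X / real (m * p) * (\<Prod>p\<in>D. 2 / real p))"
    using insert.hyps by (simp add: field_simps)
  have combine: "\<bar>u + v - 2 * w\<bar> \<le> 2 * e" if "\<bar>u - w\<bar> \<le> e" "\<bar>v - w\<bar> \<le> e"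
    for u v w e :: real using that by linarith
  have "2 ^ card (insert p D) = 2 * (2::real) ^ card D" using insert.hyps by simp
  then show ?case unfolding split card main
    using combine[OF IH[of b] IH[of c]] by (simp only:)
qed

section \<open>Brun's pure sieve\<close>

text \<open>
  Grouping the subsets by size turns the right-hand side into a partial alternating sum of binomial
  coefficients, which equals \<open>(card M - 1) gchoose k\<close> for even \<open>k\<close>. This is \<open>1\<close> for empty \<open>M\<close>, where
  the upper index is \<open>-1\<close>, and an ordinary binomial coefficient, hence nonnegative, otherwise.
\<close>

lemma Bonferroni_upper:
  assumes "finite M" "even k"
  shows "(if M = {} then 1 else 0 :: real) \<le> (\<Sum>D | D \<subseteq> M \<and> card D \<le> k. (-1) ^ card D)"
proof -
  have "(\<Sum>D | D \<subseteq> M \<and> card D \<le> k. (-1) ^ card D :: real)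
      = (\<Sum>j\<le>k. \<Sum>D | D \<in> {D. D \<subseteq> M \<and> card D \<le> k} \<and> card D = j. (-1) ^ card D)"
    using assms by (intro sum.group[symmetric]) auto
  also have "\<dots> = (\<Sum>j\<le>k. (real (card M) gchoose j) * (-1) ^ j)"
  proof (rule sum.cong[OF refl])
    fix j assume "j \<in> {..k}"
    then have "{D \<in> {D. D \<subseteq> M \<and> card D \<le> k}. card D = j} = {D. D \<subseteq> M \<and> card D = j}" by auto
    then show "(\<Sum>D | D \<in> {D. D \<subseteq> M \<and> card D \<le> k} \<and> card D = j. (-1) ^ card D)
        = (real (card M) gchoose j) * (-1) ^ j"
      using n_subsets[OF assms(1), of j] by (simp add: binomial_gbinomial)
  qed
  also have "\<dots> = (real (card M) - 1) gchoose k"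
    using assms(2) by (simp add: gbinomial_sum_lower_neg)
  also have "\<dots> \<ge> (if M = {} then 1 else 0)"
  proof (cases "M = {}")
    case True
    then show ?thesis using assms(2) gbinomial_minus[of "1::real" k]
      by (simp add: binomial_gbinomial[symmetric])
  next
    case False
    then have "card M \<ge> 1" using assms(1) by (simp add: Suc_leI card_gt_0_iff)
    then have "real (card M) - 1 gchoose k = real (card M - 1 choose k)"
      by (simp only: binomial_gbinomial of_nat_diff of_nat_1)
    then have "real (card M) - 1 gchoose k \<ge> 0" by (simp only: of_nat_0_le_iff)
    then show ?thesis using False by (simp only: if_False)
  qed
  finally show ?thesis .
qed

text \<open>
  There are at most \<open>card P ^ j\<close> subsets of size \<open>j\<close>, and weighting these by \<open>k choose j \<ge> 1\<close>
  completes the sum to a binomial expansion.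
\<close>

lemma sum_power_card_le:
  assumes "finite P"
  shows "(\<Sum>D | D \<subseteq> P \<and> card D \<le> k. (2::real) ^ card D) \<le> (1 + 2 * real (card P)) ^ k"
proof -
  have "(\<Sum>D | D \<subseteq> P \<and> card D \<le> k. (2::real) ^ card D)
      = (\<Sum>j\<le>k. \<Sum>D | D \<in> {D. D \<subseteq> P \<and> card D \<le> k} \<and> card D = j. 2 ^ card D)"
    using assms by (intro sum.group[symmetric]) auto
  also have "\<dots> \<le> (\<Sum>j\<le>k. of_nat (k choose j) * (2 * real (card P)) ^ j)"
  proof (rule sum_mono)
    fix j assume j: "j \<in> {..k}"
    then have eq: "{D \<in> {D. D \<subseteq> P \<and> card D \<le> k}. card D = j} = {D. D \<subseteq> P \<and> card D = j}" by auto
    have "(\<Sum>D | D \<in> {D. D \<subseteq> P \<and> card D \<le> k} \<and> card D = j. (2::real) ^ card D)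
        = real (card P choose j) * 2 ^ j"
      unfolding eq using n_subsets[OF assms, of j] by simp
    also have "\<dots> \<le> real (card P) ^ j * 2 ^ j"
    proof -
      have "card P choose j \<le> card P ^ j"
        by (cases "j \<le> card P") (auto simp: binomial_le_pow binomial_eq_0)
      then show ?thesis by (simp flip: of_nat_power)
    qed
    also have "\<dots> \<le> of_nat (k choose j) * (2 * real (card P)) ^ j"
    proof -
      have "real (k choose j) \<ge> 1" using j by (simp add: Suc_leI)
      then show ?thesis
        using mult_right_mono[of 1 "real (k choose j)" "(2 * real (card P)) ^ j"]
        by (simp add: power_mult_distrib mult.commute)
    qed
    finally show "(\<Sum>D | D \<in> {D. D \<subseteq> P \<and> card D \<le> k} \<and> card D = j. (2::real) ^ card D)
        \<le> of_nat (k choose j) * (2 * real (card P)) ^ j" .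
  qed
  also have "\<dots> = (2 * real (card P) + 1) ^ k"
    by (subst binomial_ring) simp
  finally show ?thesis by (simp add: add.commute)
qed

text \<open>
  Rankin's trick: on the sets in question the factor \<open>exp (card D - k)\<close> is at least \<open>1\<close>. Inserting it
  and then summing over all subsets of \<open>P\<close> leaves \<open>exp (- k)\<close> times a product of factors
  \<open>1 + exp 1 * f p\<close>; the constant \<open>3\<close> stands for \<open>exp 1\<close>.
\<close>

lemma Rankin_tail:
  fixes f :: "'a \<Rightarrow> real"
  assumes "finite P" "\<And>p. p \<in> P \<Longrightarrow> f p \<ge> 0"
  shows "(\<Sum>D | D \<subseteq> P \<and> k < card D. \<Prod>p\<in>D. f p) \<le> exp (3 * (\<Sum>p\<in>P. f p) - real k)"
proof -
  have "(\<Sum>D | D \<subseteq> P \<and> k < card D. \<Prod>p\<in>D. f p)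
      \<le> (\<Sum>D | D \<subseteq> P \<and> k < card D. exp (- real k) * (\<Prod>p\<in>D. exp 1 * f p))"
  proof (rule sum_mono)
    fix D assume "D \<in> {D. D \<subseteq> P \<and> k < card D}"
    then have D: "D \<subseteq> P" "k < card D" by auto
    have "(\<Prod>p\<in>D. f p) \<ge> 0" using D assms by (intro prod_nonneg) auto
    moreover have "1 \<le> exp (- real k) * exp (real (card D))"
      using D by (simp flip: exp_add)
    ultimately have "(\<Prod>p\<in>D. f p) \<le> exp (- real k) * exp (real (card D)) * (\<Prod>p\<in>D. f p)"
      using mult_right_mono by fastforce
    then show "(\<Prod>p\<in>D. f p) \<le> exp (- real k) * (\<Prod>p\<in>D. exp 1 * f p)"
      by (simp add: prod.distrib exp_of_nat_mult[of _ 1, simplified] mult.assoc)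
  qed
  also have "\<dots> \<le> (\<Sum>D\<in>Pow P. exp (- real k) * (\<Prod>p\<in>D. exp 1 * f p))"
    using assms by (intro sum_mono2) (auto intro!: mult_nonneg_nonneg prod_nonneg)
  also have "\<dots> = exp (- real k) * (\<Prod>p\<in>P. exp 1 * f p + 1)"
    by (subst prod_add[OF assms(1)]) (simp add: sum_distrib_left)
  also have "\<dots> \<le> exp (- real k) * exp (\<Sum>p\<in>P. exp 1 * f p)"
    using assms by (subst add.commute, intro mult_left_mono prod_one_plus_le_exp_sum)
      (auto intro!: add_nonneg_nonneg)
  also have "\<dots> \<le> exp (- real k) * exp (3 * (\<Sum>p\<in>P. f p))"
    using assms exp_le by (auto simp flip: sum_distrib_left intro!: mult_right_mono sum_nonneg)
  finally show ?thesis by (simp flip: exp_add)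
qed

text \<open>
  For each \<open>n\<close> the Bonferroni inequality is applied to the set of primes in \<open>P\<close> that divide
  \<open>n * (n + 2)\<close>. After exchanging the sums, a set \<open>D\<close> contributes, up to sign, the
  number of \<open>n\<close> such that every \<open>p \<in> D\<close> divides \<open>n * (n + 2)\<close>, which is known up to \<open>2 ^ card D\<close>.
\<close>

lemma Brun_sieve_truncated:
  assumes "finite P" "\<And>p. p \<in> P \<Longrightarrow> prime p \<and> odd p" "even k"
  shows "real (card {n. n < X \<and> (\<forall>p\<in>P. \<not> p dvd n * (n + 2))})
    \<le> real X * (\<Sum>D | D \<subseteq> P \<and> card D \<le> k. (-1) ^ card D * (\<Prod>p\<in>D. 2 / real p))
        + (1 + 2 * real (card P)) ^ k"
proof -
  define \<D> where "\<D> = {D. D \<subseteq> P \<and> card D \<le> k}"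
  have fin: "finite \<D>" using assms(1) by (simp add: \<D>_def)
  define M where "M n = {p \<in> P. p dvd n * (n + 2)}" for n
  have "real (card {n. n < X \<and> (\<forall>p\<in>P. \<not> p dvd n * (n + 2))})
      = (\<Sum>n<X. if M n = {} then 1 else 0)"
  proof -
    have "{n. n < X \<and> (\<forall>p\<in>P. \<not> p dvd n * (n + 2))} = {n \<in> {..<X}. M n = {}}"
      by (auto simp: M_def)
    then show ?thesis by (simp add: sum.If_cases Int_def)
  qed
  also have "\<dots> \<le> (\<Sum>n<X. \<Sum>D | D \<subseteq> M n \<and> card D \<le> k. (-1) ^ card D)"
    using assms by (intro sum_mono Bonferroni_upper) (auto simp: M_def)
  also have "\<dots> = (\<Sum>n<X. \<Sum>D\<in>\<D>. if D \<subseteq> M n then (-1) ^ card D else 0)"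
  proof (rule sum.cong[OF refl])
    fix n
    have "{D. D \<subseteq> M n \<and> card D \<le> k} = {D \<in> \<D>. D \<subseteq> M n}" by (auto simp: \<D>_def M_def)
    then show "(\<Sum>D | D \<subseteq> M n \<and> card D \<le> k. (-1) ^ card D)
        = (\<Sum>D\<in>\<D>. if D \<subseteq> M n then (-1) ^ card D else (0::real))"
      using fin by (simp add: sum.inter_filter)
  qed
  also have "\<dots> = (\<Sum>D\<in>\<D>. \<Sum>n<X. if D \<subseteq> M n then (-1) ^ card D else 0)"
    by (rule sum.swap)
  also have "\<dots> \<le> (\<Sum>D\<in>\<D>. real X * ((-1) ^ card D * (\<Prod>p\<in>D. 2 / real p)) + 2 ^ card D)"
  proof (rule sum_mono)
    fix D assume "D \<in> \<D>"
    then have D: "D \<subseteq> P" by (simp add: \<D>_def)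
    then have finD: "finite D" using assms(1) finite_subset by blast
    have "{n \<in> {..<X}. D \<subseteq> M n} = {n. n < X \<and> [n = 0] (mod 1) \<and> (\<forall>p\<in>D. p dvd n * (n + 2))}"
      using D by (auto simp: M_def)
    then have "(\<Sum>n<X. if D \<subseteq> M n then (-1) ^ card D else (0::real))
        = (-1) ^ card D * real (card {n. n < X \<and> [n = 0] (mod 1) \<and> (\<forall>p\<in>D. p dvd n * (n + 2))})"
      by (simp add: sum.If_cases Int_def)
    moreover have "\<bar>real (card {n. n < X \<and> [n = 0] (mod 1) \<and> (\<forall>p\<in>D. p dvd n * (n + 2))})
        - real X / real 1 * (\<Prod>p\<in>D. 2 / real p)\<bar> \<le> 2 ^ card D"
      using assms D finD by (intro card_twin_residues) auto
    ultimately show "(\<Sum>n<X. if D \<subseteq> M n then (-1) ^ card D else (0::real))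
        \<le> real X * ((-1) ^ card D * (\<Prod>p\<in>D. 2 / real p)) + 2 ^ card D"
      by (cases "even (card D)") (auto simp: abs_le_iff)
  qed
  also have "\<dots> = real X * (\<Sum>D\<in>\<D>. (-1) ^ card D * (\<Prod>p\<in>D. 2 / real p)) + (\<Sum>D\<in>\<D>. 2 ^ card D)"
    by (simp add: sum.distrib sum_distrib_left)
  also have "(\<Sum>D\<in>\<D>. (2::real) ^ card D) \<le> (1 + 2 * real (card P)) ^ k"
    unfolding \<D>_def by (rule sum_power_card_le[OF assms(1)])
  finally show ?thesis by (simp add: \<D>_def)
qed

text \<open>
  The full alternating sum is \<open>\<Prod>p\<in>P. 1 - 2 / p\<close>. The truncation costs at most
  \<open>exp (3 * (2 * S) - k)\<close> with \<open>S = \<Sum>p\<in>P. 1 / p\<close>, and \<open>k \<ge> 8 * S\<close> is what makes this no larger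
  than the bound \<open>exp (- 2 * S)\<close> for the product.
\<close>

lemma Brun_sieve:
  assumes "finite P" "\<And>p. p \<in> P \<Longrightarrow> prime p \<and> odd p" "even k"
    and k: "8 * (\<Sum>p\<in>P. 1 / real p) \<le> real k"
  shows "real (card {n. n < X \<and> (\<forall>p\<in>P. \<not> p dvd n * (n + 2))})
    \<le> 2 * real X * exp (- 2 * (\<Sum>p\<in>P. 1 / real p)) + (1 + 2 * real (card P)) ^ k"
proof -
  define S where "S = (\<Sum>p\<in>P. 1 / real p)"
  define F :: "nat set \<Rightarrow> real" where "F D = (-1) ^ card D * (\<Prod>p\<in>D. 2 / real p)" for D
  have S2: "(\<Sum>p\<in>P. 2 / real p) = 2 * S" by (simp add: S_def sum_distrib_left)
  have "(\<Sum>D\<in>Pow P. F D) = (\<Sum>D | D \<subseteq> P \<and> card D \<le> k. F D) + (\<Sum>D | D \<subseteq> P \<and> k < card D. F D)"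
    using assms(1) by (subst sum.union_disjoint[symmetric]) (auto intro!: sum.cong)
  moreover have "(\<Sum>D\<in>Pow P. F D) = (\<Prod>p\<in>P. 1 - 2 / real p)"
    by (simp add: F_def prod_diff_conv_sum[OF assms(1)])
  moreover have "(\<Prod>p\<in>P. 1 - 2 / real p) \<le> exp (- 2 * S)"
  proof -
    have "2 / real p \<le> 1" if "p \<in> P" for p
      using assms(2)[OF that] prime_ge_2_nat[of p] by simp
    then have "(\<Prod>p\<in>P. 1 + - (2 / real p)) \<le> exp (\<Sum>p\<in>P. - (2 / real p))"
      by (intro prod_one_plus_le_exp_sum) simp
    then show ?thesis using S2 by (simp add: sum_negf)
  qed
  moreover have "- (\<Sum>D | D \<subseteq> P \<and> k < card D. F D) \<le> exp (- 2 * S)"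
  proof -
    have "- (\<Sum>D | D \<subseteq> P \<and> k < card D. F D) \<le> (\<Sum>D | D \<subseteq> P \<and> k < card D. \<Prod>p\<in>D. 2 / real p)"
    proof (subst sum_negf[symmetric], rule sum_mono)
      fix D :: "nat set"
      have "(\<Prod>p\<in>D. 2 / real p) \<ge> 0" by (intro prod_nonneg) auto
      then show "- F D \<le> (\<Prod>p\<in>D. 2 / real p)" by (cases "even (card D)") (auto simp: F_def)
    qed
    also have "\<dots> \<le> exp (3 * (\<Sum>p\<in>P. 2 / real p) - real k)"
      using assms(1) by (intro Rankin_tail) auto
    also have "\<dots> \<le> exp (- 2 * S)" using k S2 by (simp add: S_def)
    finally show ?thesis .
  qed
  ultimately have "(\<Sum>D | D \<subseteq> P \<and> card D \<le> k. F D) \<le> 2 * exp (- 2 * S)" by linarith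
  then have "real X * (\<Sum>D | D \<subseteq> P \<and> card D \<le> k. F D) \<le> real X * (2 * exp (- 2 * S))"
    by (intro mult_left_mono) auto
  then show ?thesis
    using Brun_sieve_truncated[OF assms(1-3), of X] by (simp add: F_def S_def mult.assoc mult.left_commute)
qed

section \<open>Twin primes have density zero among the primes\<close>

lemma twin_pairs_below_gap_2:
  assumes "(p, p') \<in> twin_pairs_below x" "p > 2"
  shows "p' = p + 2"
proof -
  have "prime p" "prime p'" "p < p'" "p' - p \<le> 2"
    using assms by (auto simp: twin_pairs_below_def consecutive_primes_def)
  moreover from this have "odd p" "odd p'" using assms(2) prime_odd_nat by auto
  ultimately show ?thesis by presburger
qed

text \<open>
  A pair of consecutive primes is determined by its lower member \<open>p\<close>. If \<open>p > N\<close>, then \<open>p\<close> and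
  \<open>p + 2\<close> are primes exceeding all of \<open>P\<close>, so \<open>p\<close> survives the sieve.
\<close>

lemma pi2_le_sieved:
  assumes "N \<ge> 2" "\<And>q. q \<in> P \<Longrightarrow> prime q \<and> q \<le> N"
  shows "pi2 x \<le> N + 1 + card {n. n < x \<and> (\<forall>q\<in>P. \<not> q dvd n * (n + 2))}"
proof -
  define A where "A = {n. n < x \<and> (\<forall>q\<in>P. \<not> q dvd n * (n + 2))}"
  have inj: "inj_on fst (twin_pairs_below x)"
    by (auto simp: inj_on_def twin_pairs_below_def consecutive_primes_def) (metis linorder_neqE_nat)
  have "fst ` twin_pairs_below x \<subseteq> {..N} \<union> A"
  proof
    fix p assume "p \<in> fst ` twin_pairs_below x"
    then obtain p' where pp: "(p, p') \<in> twin_pairs_below x" by auto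
    have "p \<in> A" if "p > N"
    proof -
      have "p' = p + 2" using twin_pairs_below_gap_2[OF pp] that assms(1) by simp
      then have pr: "prime p" "prime (p + 2)" "p < x"
        using pp by (auto simp: twin_pairs_below_def consecutive_primes_def)
      have "\<not> q dvd p * (p + 2)" if "q \<in> P" for q
      proof -
        have "prime q" "q < p" using assms(2)[OF that] \<open>p > N\<close> by auto
        then have "\<not> q dvd p" "\<not> q dvd p + 2"
          using primes_dvd_imp_eq[of q p] primes_dvd_imp_eq[of q "p + 2"] pr by auto
        then show ?thesis
          unfolding prime_dvd_mult_iff[OF \<open>prime q\<close>] by simp
      qed
      then show ?thesis using pr by (simp add: A_def)
    qed
    then show "p \<in> {..N} \<union> A" by force
  qed
  then have "card (fst ` twin_pairs_below x) \<le> card ({..N} \<union> A)"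
    by (intro card_mono) (auto simp: A_def)
  also have "\<dots> \<le> card {..N} + card A" by (rule card_Un_le)
  finally show ?thesis using card_image[OF inj] by (simp add: pi2_def A_def)
qed

text \<open>
  Discarding elements one at a time lowers the sum by at most \<open>1\<close> per step, so it cannot jump over
  an interval of length \<open>1\<close>.
\<close>

lemma exists_subset_sum_between:
  fixes f :: "'a \<Rightarrow> real"
  assumes "finite A" "\<And>a. a \<in> A \<Longrightarrow> f a \<le> 1" "t \<ge> 0" "t \<le> sum f A"
  shows "\<exists>B\<subseteq>A. t \<le> sum f B \<and> sum f B \<le> t + 1"
  using assms
proof (induction A rule: finite_induct)
  case empty
  then show ?case by auto
next
  case (insert a A)
  show ?case
  proof (cases "t \<le> sum f A")
    case True
    then show ?thesis using insert by (metis insertI2 subset_insertI2)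
  next
    case False
    then have "sum f (insert a A) \<le> t + 1"
      using insert.hyps insert.prems(1)[of a] by simp
    then show ?thesis using insert.prems by blast
  qed
qed

text \<open>
  The parameter \<open>t\<close> prescribes the amount of sieving: \<open>P\<close> is a set of odd primes up to \<open>N\<close> whose
  reciprocals sum to something between \<open>t\<close> and \<open>t + 1\<close>. An even \<open>k\<close> with
  \<open>8 * (t + 1) \<le> k \<le> 8 * t + 10\<close> then qualifies, and the upper bound on \<open>k\<close> limits the error.
\<close>

lemma pi2_le:
  assumes N: "N \<ge> 2" and t: "0 \<le> t" "t \<le> ln (ln (real N + 1)) - 3 / 2"
  shows "real (pi2 x) \<le> real N + 1 + 2 * real x * exp (- 2 * t) + (3 * real N) powr (8 * t + 10)"
proof -
  define Q where "Q = {p. prime p \<and> odd p \<and> p \<le> N}"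
  have finQ: "finite Q" by (rule finite_subset[of _ "{..N}"]) (auto simp: Q_def)
  have "t \<le> (\<Sum>p\<in>Q. 1 / real p)"
    using t sum_odd_prime_reciprocals_ge[OF N] by (simp add: Q_def)
  moreover have "1 / real p \<le> 1" if "p \<in> Q" for p
    using that prime_gt_0_nat[of p] by (auto simp: Q_def)
  ultimately obtain P where P: "P \<subseteq> Q" "t \<le> (\<Sum>p\<in>P. 1 / real p)" "(\<Sum>p\<in>P. 1 / real p) \<le> t + 1"
    using exists_subset_sum_between[OF finQ, of "\<lambda>p. 1 / real p" t] t by auto
  have finP: "finite P" using P finQ finite_subset by blast
  define k where "k = 2 * nat \<lceil>4 * (t + 1)\<rceil>"
  have k: "8 * (t + 1) \<le> real k" "real k \<le> 8 * t + 10"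
    using t by (auto simp: k_def) linarith+
  have "Q \<subseteq> {1..N}" by (auto simp: Q_def Suc_leI prime_gt_0_nat)
  then have "card P \<le> N" using P card_mono[of "{1..N}" P] by auto
  then have "(1 + 2 * real (card P)) ^ k \<le> (3 * real N) ^ k"
    using N by (intro power_mono) auto
  also have "\<dots> = (3 * real N) powr real k" using N by (simp add: powr_realpow)
  also have "\<dots> \<le> (3 * real N) powr (8 * t + 10)" using k N by (intro powr_mono) auto
  finally have err: "(1 + 2 * real (card P)) ^ k \<le> (3 * real N) powr (8 * t + 10)" .
  have "real (card {n. n < x \<and> (\<forall>p\<in>P. \<not> p dvd n * (n + 2))})
    \<le> 2 * real x * exp (- 2 * (\<Sum>p\<in>P. 1 / real p)) + (1 + 2 * real (card P)) ^ k"
    using finP P k by (intro Brun_sieve) (auto simp: Q_def k_def)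
  also have "\<dots> \<le> 2 * real x * exp (- 2 * t) + (3 * real N) powr (8 * t + 10)"
    using P err by (intro add_mono mult_left_mono) auto
  finally have "real (card {n. n < x \<and> (\<forall>p\<in>P. \<not> p dvd n * (n + 2))})
    \<le> 2 * real x * exp (- 2 * t) + (3 * real N) powr (8 * t + 10)" .
  moreover have "real (pi2 x) \<le> real (N + 1 + card {n. n < x \<and> (\<forall>q\<in>P. \<not> q dvd n * (n + 2))})"
    using N P by (subst of_nat_le_iff, intro pi2_le_sieved) (auto simp: Q_def)
  ultimately show ?thesis by simp
qed

text \<open>
  With \<open>t = 0.6 * ln (ln x)\<close> the main term is of order \<open>x / (ln x) powr 1.2\<close>, which is
  \<open>o(x / ln x)\<close> because \<open>0.6 > 1 / 2\<close>. Primes up to \<open>y = exp ((ln x) powr 0.7)\<close> have a large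
  enough reciprocal sum, about \<open>0.7 * ln (ln x)\<close>, and since \<open>0.7 < 1\<close> the error term
  \<open>(3 * y) powr O(ln (ln x))\<close> is still \<open>x powr o(1)\<close>.
\<close>

lemma pi2_little_o: "(\<lambda>x. real (pi2 x) * ln (real x) / real x) \<longlonglongrightarrow> 0"
proof -
  define t where "t x = 0.6 * ln (ln (real x))" for x :: nat
  define y where "y x = exp (ln (real x) powr 0.7)" for x :: nat
  define B where "B x = y x + 1 + 2 * real x * exp (- 2 * t x) + (3 * y x) powr (8 * t x + 10)" for x
  have "eventually (\<lambda>x. 0 \<le> t x) at_top" unfolding t_def by real_asymp
  moreover have "eventually (\<lambda>x. t x \<le> ln (ln (y x)) - 3 / 2) at_top" 
    unfolding t_def y_def by real_asymp
  moreover have "eventually (\<lambda>x. y x \<ge> 3) at_top" unfolding y_def by real_asymp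
  ultimately have bound: "eventually (\<lambda>x. real (pi2 x) \<le> B x) at_top"
  proof eventually_elim
    case (elim x)
    define N where "N = nat \<lfloor>y x\<rfloor>"
    have N: "N \<ge> 2" "real N \<le> y x" "y x \<le> real N + 1"
      using elim(3) unfolding N_def by linarith+
    have "ln (y x) > 0" using elim(3) by simp
    then have "ln (ln (y x)) \<le> ln (ln (real N + 1))" using N elim(3) by simp
    then have "t x \<le> ln (ln (real N + 1)) - 3 / 2" using elim(2) by linarith
    then have "real (pi2 x) \<le> real N + 1 + 2 * real x * exp (- 2 * t x) + (3 * real N) powr (8 * t x + 10)"
      using elim N by (intro pi2_le) auto
    also have "\<dots> \<le> B x" unfolding B_def
      using N elim by (intro add_mono powr_mono2) auto
    finally show ?case .
  qed
  have lim: "(\<lambda>x. B x * ln (real x) / real x) \<longlonglongrightarrow> 0"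
    unfolding B_def t_def y_def by real_asymp
  have "eventually (\<lambda>x::nat. x \<ge> 1) at_top" by (rule eventually_ge_at_top)
  with bound have "eventually (\<lambda>x. real (pi2 x) * ln (real x) / real x \<le> B x * ln (real x) / real x) at_top"
    by eventually_elim (intro divide_right_mono mult_right_mono; simp)
  moreover have "eventually (\<lambda>x::nat. 0 \<le> real (pi2 x) * ln (real x) / real x) at_top"
    using eventually_ge_at_top[of "1::nat"] by eventually_elim simp
  ultimately show ?thesis
    by (intro tendsto_sandwich[OF _ _ tendsto_const lim])
qed

lemma pi2_pos:
  assumes "x > 3"
  shows "pi2 x > 0"
proof -
  have "(2, 3) \<in> twin_pairs_below x"
    using assms by (auto simp: twin_pairs_below_def consecutive_primes_def)
  then show ?thesis
    unfolding pi2_def using finite_twin_pairs_below card_gt_0_iff by blast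
qed

theorem theorem4p1:
  "\<exists>h :: nat \<Rightarrow> real.
     ((\<lambda>x. h x / ln (real x)) \<longlongrightarrow> 0) at_top_odd_composites \<and>
     ((\<lambda>x. real (pi2 x) / ((2 + h x) * (real x / (ln (real x))\<^sup>2))) \<longlongrightarrow> 1)
       at_top_odd_composites"
proof (intro exI conjI)
  define h where "h x = real (pi2 x) * (ln (real x))\<^sup>2 / real x - 2" for x
  have le: "at_top_odd_composites \<le> at_top" by (simp add: at_top_odd_composites_def)
  have "(\<lambda>x. real (pi2 x) * ln (real x) / real x - 2 / ln (real x)) \<longlonglongrightarrow> 0 - 0"
    by (intro tendsto_diff pi2_little_o) real_asymp
  moreover have "eventually (\<lambda>x. real (pi2 x) * ln (real x) / real x - 2 / ln (real x)
      = h x / ln (real x)) at_top"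
    using eventually_gt_at_top[of "3::nat"]
    by eventually_elim (simp add: h_def field_simps power2_eq_square)
  ultimately have "(\<lambda>x. h x / ln (real x)) \<longlonglongrightarrow> 0"
    by (auto dest: tendsto_cong)
  then show "((\<lambda>x. h x / ln (real x)) \<longlongrightarrow> 0) at_top_odd_composites"
    using le by (rule tendsto_mono[rotated])
  have "eventually (\<lambda>x. real (pi2 x) / ((2 + h x) * (real x / (ln (real x))\<^sup>2)) = 1) at_top"
    using eventually_gt_at_top[of "3::nat"]
  proof eventually_elim
    case (elim x)
    then show ?case using pi2_pos[of x] by (simp add: h_def)
  qed
  then have "((\<lambda>x. real (pi2 x) / ((2 + h x) * (real x / (ln (real x))\<^sup>2))) \<longlongrightarrow> 1) at_top"
    by (rule tendsto_eventually)
  then show "((\<lambda>x. real (pi2 x) / ((2 + h x) * (real x / (ln (real x))\<^sup>2))) \<longlongrightarrow> 1) at_top_odd_composites"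
    using le by (rule tendsto_mono[rotated])
qed

end
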